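(* The optimal interdiction value function $y$ of the parametric matroid $\ell$-interdiction problem has at most $$\binom{m}{2}\binom{k+\ell-2}{\ell-1}\,k\;\in\;\mathcal{O}\big(m^2(k+\ell)^{\ell-1}k\big)$$ changepoints.
   Context: Let $\mathcal{M}=(E,\mathcal{F})$ be a matroid on a finite ground set $E$ with family of independent sets $\mathcal{F}$, $m=|E|$, and rank $k$. Each $e\in E$ has a parametric weight $w(e,\lambda)=a_e+\lambda b_e$ with $a_e,b_e\in\mathbb{Q}$, where the parameter $\lambda$ ranges over a real interval $I\subseteq\mathbb{R}$; for $A\subseteq E$ put $w(A,\lambda)=\sum_{e\in A}w(e,\lambda)$. Let $\ell\in\mathbb{N}_{>0}$ be the number of elements allowed to be interdicted. For $F\subseteq E$, $\mathcal{M}_F$ denotes the restriction of $\mathcal{M}$ to $E\setminus F$; $B_\lambda^*$ denotes a minimum weight basis of $\mathcal{M}$ at $\lambda$ and $B_\lambda^F$ a minimum weight basis of $\mathcal{M}_F$ at $\lambda$. An equality point is a $\lambda\in I$ with $w(e,\lambda)=w(f,\lambda)$ for some $e\neq f$. Standing assumptions: (a) $\ell$ is constant; (b) for every $F\subseteq E$ with $|F|=\ell$ the matroid $\mathcal{M}_F$ has a basis of cardinality $k$; (c) optimal bases $B_\lambda^*$ and $B_\lambda^F$ are unique (at equality points ties are resolved by a fixed ordering of the elements); (d) no two different pairs of elements have equal weights at the same $\lambda$, and no two elements have identical weight functions. For $F\subseteq E$ with $|F|=\ell$ define $y_F\colon I\to\mathbb{R}$, $y_F(\lambda)=w(B_\lambda^F,\lambda)$.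 The optimal interdiction value function is $y\colon I\to\mathbb{R}$, $y(\lambda)=\max\{y_F(\lambda): F\subseteq E,\ |F|=\ell\}$. It is piecewise linear and continuous; its changepoints are the points at which its slope changes. *)

theory Defs
  imports "HOL-Analysis.Analysis" "HOL-Library.Landau_Symbols"
begin

locale matroid =
  fixes E :: "'a set" and \<F> :: "'a set set"
  assumes finite_ground: "finite E"
    and indep_subset_ground: "A \<in> \<F> \<Longrightarrow> A \<subseteq> E"
    and empty_indep: "{} \<in> \<F>"
    and indep_subset: "A \<in> \<F> \<Longrightarrow> B \<subseteq> A \<Longrightarrow> B \<in> \<F>"
    and augmentation:
      "A \<in> \<F> \<Longrightarrow> B \<in> \<F> \<Longrightarrow> card A < card B \<Longrightarrow> \<exists>e\<in>B - A. insert e A \<in> \<F>"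

definition matroid_rank :: "'a set set \<Rightarrow> nat" where
  "matroid_rank \<F> = Max (card ` \<F>)"

definition is_basis :: "'a set set \<Rightarrow> 'a set \<Rightarrow> bool" where
  "is_basis \<F> B \<longleftrightarrow> B \<in> \<F> \<and> (\<forall>A\<in>\<F>. B \<subseteq> A \<longrightarrow> A = B)"

text \<open>Independent sets of the restriction to \<^term>\<open>E - F\<close>, for \<^term>\<open>\<F>\<close> the independent
  sets of a matroid on \<^term>\<open>E\<close>.\<close>

definition interdict :: "'a set set \<Rightarrow> 'a set \<Rightarrow> 'a set set" where
  "interdict \<F> F = {A \<in> \<F>. A \<inter> F = {}}"

definition weight :: "('a \<Rightarrow> rat) \<Rightarrow> ('a \<Rightarrow> rat) \<Rightarrow> 'a \<Rightarrow> real \<Rightarrow> real" where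
  "weight a b e t = of_rat (a e) + t * of_rat (b e)"

definition set_weight :: "('a \<Rightarrow> rat) \<Rightarrow> ('a \<Rightarrow> rat) \<Rightarrow> 'a set \<Rightarrow> real \<Rightarrow> real" where
  "set_weight a b A t = (\<Sum>e\<in>A. weight a b e t)"

definition is_min_basis ::
  "('a \<Rightarrow> rat) \<Rightarrow> ('a \<Rightarrow> rat) \<Rightarrow> 'a set set \<Rightarrow> real \<Rightarrow> 'a set \<Rightarrow> bool" where
  "is_min_basis a b \<F> t B \<longleftrightarrow>
     is_basis \<F> B \<and> (\<forall>B'. is_basis \<F> B' \<longrightarrow> set_weight a b B t \<le> set_weight a b B' t)"

text \<open>For a linear order \<^term>\<open>r\<close> this compares sets lexicographically: the \<^term>\<open>r\<close>-least
  element of the symmetric difference lies in \<^term>\<open>B\<close>.\<close>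

definition tie_less :: "'a rel \<Rightarrow> 'a set \<Rightarrow> 'a set \<Rightarrow> bool" where
  "tie_less r B B' \<longleftrightarrow> (\<exists>e\<in>B - B'. \<forall>f\<in>B' - B. (e, f) \<in> r)"

text \<open>The minimum weight basis; ties are resolved by the fixed order \<^term>\<open>r\<close> on the elements.\<close>

definition opt_basis ::
  "'a rel \<Rightarrow> ('a \<Rightarrow> rat) \<Rightarrow> ('a \<Rightarrow> rat) \<Rightarrow> 'a set set \<Rightarrow> real \<Rightarrow> 'a set" where
  "opt_basis r a b \<F> t = (THE B. is_min_basis a b \<F> t B \<and>
     (\<forall>B'. is_min_basis a b \<F> t B' \<longrightarrow> B' \<noteq> B \<longrightarrow> tie_less r B B'))"

definition interdicted_value ::
  "'a rel \<Rightarrow> ('a \<Rightarrow> rat) \<Rightarrow> ('a \<Rightarrow> rat) \<Rightarrow> 'a set set \<Rightarrow> 'a set \<Rightarrow> real \<Rightarrow> real" where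
  "interdicted_value r a b \<F> F t = set_weight a b (opt_basis r a b (interdict \<F> F) t) t"

definition opt_interdiction_value ::
  "'a rel \<Rightarrow> ('a \<Rightarrow> rat) \<Rightarrow> ('a \<Rightarrow> rat) \<Rightarrow> 'a set \<Rightarrow> 'a set set \<Rightarrow> nat \<Rightarrow> real \<Rightarrow> real" where
  "opt_interdiction_value r a b E \<F> l t =
     Max {interdicted_value r a b \<F> F t | F. F \<subseteq> E \<and> card F = l}"

text \<open>The points of \<^term>\<open>I\<close> around which \<^term>\<open>y\<close>, as a function on \<^term>\<open>I\<close>, does not have one
  constant slope. Lemma \<open>changepoint_iff_slopes_differ\<close> relates this to left and right slopes.\<close>

definition changepoints :: "real set \<Rightarrow> (real \<Rightarrow> real) \<Rightarrow> real set" where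
  "changepoints I y =
     {t \<in> I. \<not> (\<exists>s. \<forall>\<^sub>F x in at t within I. y x = y t + s * (x - t))}"

lemma changepoint_iff_slopes_differ:
  assumes "t \<in> interior I"
    and left: "\<forall>\<^sub>F x in at_left t. y x = y t + s * (x - t)"
    and right: "\<forall>\<^sub>F x in at_right t. y x = y t + s' * (x - t)"
  shows "t \<in> changepoints I y \<longleftrightarrow> s \<noteq> s'"
proof -
  have at: "at t within I = at t"
    using assms(1) by (rule at_within_interior)
  have lt: "\<forall>\<^sub>F x in at_left t. x < t" and gt: "\<forall>\<^sub>F x in at_right t. t < x"
    by (auto simp: eventually_at_filter)
  have eq: "s = u" if "\<forall>\<^sub>F x in at_left t. y x = y t + u * (x - t)" for u
  proof -
    have "\<forall>\<^sub>F x in at_left t. s = u"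
      using left that lt by eventually_elim auto
    then show ?thesis by simp
  qed
  have eq': "s' = u" if "\<forall>\<^sub>F x in at_right t. y x = y t + u * (x - t)" for u
  proof -
    have "\<forall>\<^sub>F x in at_right t. s' = u"
      using right that gt by eventually_elim auto
    then show ?thesis by simp
  qed
  have "t \<in> I"
    using assms(1) interior_subset by blast
  then have "t \<in> changepoints I y \<longleftrightarrow>
      \<not> (\<exists>u. (\<forall>\<^sub>F x in at_left t. y x = y t + u * (x - t)) \<and>
             (\<forall>\<^sub>F x in at_right t. y x = y t + u * (x - t)))"
    by (simp add: changepoints_def at eventually_at_split)
  also have "\<dots> \<longleftrightarrow> s \<noteq> s'"
    using left right by (blast dest: eq eq')
  finally show ?thesis .
qed

lemma opt_basis_unique:
  assumes "matroid E \<F>" and r: "linear_order_on E r"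
  shows "\<exists>!B. is_min_basis a b (interdict \<F> F) t B \<and>
    (\<forall>B'. is_min_basis a b (interdict \<F> F) t B' \<longrightarrow> B' \<noteq> B \<longrightarrow> tie_less r B B')"
proof -
  interpret matroid E \<F> by fact
  have r': "refl_on E r" "trans r" "antisym r" "total_on E r"
    using r by (simp_all add: order_on_defs)
  have tr: "(x, z) \<in> r" if "(x, y) \<in> r" "(y, z) \<in> r" for x y z
    by (rule transD[OF r'(2) that])
  have anti: "x = y" if "(x, y) \<in> r" "(y, x) \<in> r" for x y
    by (rule antisymD[OF r'(3) that])
  have tot: "(x, y) \<in> r \<or> (y, x) \<in> r" if "x \<in> E" "y \<in> E" for x y
    using that r'(1,4) by (metis refl_onD total_on_def)
  let ?I = "interdict \<F> F"
  let ?S = "{B. is_basis ?I B}"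
  let ?M = "{B. is_min_basis a b ?I t B}"
  have subE: "A \<subseteq> E" if "A \<in> ?I" for A
    using that indep_subset_ground by (auto simp: interdict_def)
  have finI: "finite ?I"
    by (rule finite_subset[of _ "Pow E"]) (use subE finite_ground in auto)
  have "{} \<in> ?I"
    using empty_indep by (simp add: interdict_def)
  then obtain B0 where "B0 \<in> ?I" "\<forall>A\<in>?I. B0 \<subseteq> A \<longrightarrow> A = B0"
    using finite_has_maximal2[OF finI] by metis
  then have "?S \<noteq> {}"
    by (auto simp: is_basis_def)
  moreover have finS: "finite ?S"
    by (rule finite_subset[OF _ finI]) (auto simp: is_basis_def)
  ultimately obtain B1 where B1: "is_arg_min (\<lambda>A. set_weight a b A t) (\<lambda>B. B \<in> ?S) B1"
    using ex_is_arg_min_if_finite by blast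
  then have "is_min_basis a b ?I t B1"
    by (simp add: is_arg_min_linorder is_min_basis_def)
  then have neM: "?M \<noteq> {}"
    by blast
  have finM: "finite ?M"
    by (rule finite_subset[OF _ finS]) (auto simp: is_min_basis_def)
  have ME: "B \<subseteq> E" if "B \<in> ?M" for B
    using that subE by (auto simp: is_min_basis_def is_basis_def)
  have trans: "tie_less r A C" if "A \<in> ?M" "B \<in> ?M" "C \<in> ?M" and AB: "tie_less r A B"
    and BC: "tie_less r B C" for A B C
  proof -
    obtain e where e: "e \<in> A - B" "\<And>f. f \<in> B - A \<Longrightarrow> (e, f) \<in> r"
      using AB by (auto simp: tie_less_def)
    obtain e' where e': "e' \<in> B - C" "\<And>f. f \<in> C - B \<Longrightarrow> (e', f) \<in> r"
      using BC by (auto simp: tie_less_def)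
    have "e \<noteq> e'" using e(1) e'(1) by auto
    have "e \<in> E" "e' \<in> E" using e(1) e'(1) ME that by auto
    then consider "(e, e') \<in> r" "(e', e) \<notin> r" | "(e', e) \<in> r" "(e, e') \<notin> r"
      using tot anti \<open>e \<noteq> e'\<close> by blast
    then show ?thesis
    proof cases
      case 1
      then have "e \<in> A - C" using e e' by blast
      moreover have "(e, f) \<in> r" if "f \<in> C - A" for f
        using that e(2)[of f] e'(2)[of f] tr[OF 1(1)] by blast
      ultimately show ?thesis by (auto simp: tie_less_def)
    next
      case 2
      then have "e' \<in> A - C" using e e' by blast
      moreover have "(e', f) \<in> r" if "f \<in> C - A" for f
        using that e(2)[of f] e'(2)[of f] tr[OF 2(1)] by blast
      ultimately show ?thesis by (auto simp: tie_less_def)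
    qed
  qed
  have asym: False if "A \<in> ?M" "B \<in> ?M" "tie_less r A B" "tie_less r B A" for A B
    using trans[OF that(1,2,1) that(3,4)] by (auto simp: tie_less_def)
  have total: "tie_less r A B \<or> tie_less r B A" if "A \<in> ?M" "B \<in> ?M" "A \<noteq> B" for A B
  proof -
    let ?D = "(A - B) \<union> (B - A)"
    have DE: "?D \<subseteq> E" using ME that by blast
    have "finite ?D" "?D \<noteq> {}"
      using finite_subset[OF DE finite_ground] that by auto
    moreover have "transp_on ?D (\<lambda>x y. (x, y) \<in> r \<and> x \<noteq> y)"
      unfolding transp_on_def by (blast intro: tr dest: anti)
    moreover have "totalp_on ?D (\<lambda>x y. (x, y) \<in> r \<and> x \<noteq> y)"
      unfolding totalp_on_def using tot DE by blast
    ultimately obtain x where "x \<in> ?D" "\<forall>y\<in>?D. y \<noteq> x \<longrightarrow> (x, y) \<in> r"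
      using Finite_Set.bex_least_element[of ?D "\<lambda>x y. (x, y) \<in> r \<and> x \<noteq> y"] by blast
    then show ?thesis by (auto simp: tie_less_def)
  qed
  have "transp_on ?M (tie_less r)"
    by (rule transp_onI) (rule trans)
  moreover have "totalp_on ?M (tie_less r)"
    by (rule totalp_onI) (rule total)
  ultimately obtain B where "B \<in> ?M" "\<forall>B'\<in>?M. B' \<noteq> B \<longrightarrow> tie_less r B B'"
    using Finite_Set.bex_least_element[OF finM neM, of "tie_less r"] by blast
  then show ?thesis
    using asym by (intro ex1I[of _ B]) blast+
qed

end

theory Submission
  imports Defs
begin

text \<open>Let \<^term>\<open>k\<close> be the rank. The value \<open>y\<^sub>F\<close> of an interdicted set \<open>F\<close> is the least weight of a
  basis that avoids \<open>F\<close>, so the tie-breaking order plays no role. By symmetric exchange a basis has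
  minimum weight as soon as no single exchange improves it (\<open>locally_min_imp_min_base\<close>), and this
  depends only on the order of the weights. Hence the optimal basis avoiding \<open>F\<close> is constant, and
  \<open>y\<^sub>F\<close> is affine, on every interval without equality points.

  On such an interval only a few sets \<open>F\<close> matter. Interdicting nothing but elements outside the
  optimal basis has no effect, so one may branch on whether a given element of the current optimal
  basis belongs to \<open>F\<close>; deleting it leaves the rest of the basis optimal
  (\<open>min_base_insert_superset\<close>). Pascal's rule gives at most \<open>T = (k + l - 1 choose l)\<close> candidates
  (\<open>candidates\<close>). So \<open>y\<close> is the upper envelope of at most \<open>T\<close> affine functions and has at most
  \<open>T - 1\<close> changepoints on the interval (\<open>changepoints_Max_affine\<close>). Cutting at \<open>N\<close> points leaves
  \<open>N + 1\<close> intervals, hence at most \<open>N + (N + 1) (T - 1) = (N + 1) T - 1\<close> changepoints.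

  There are at most \<open>m choose 2\<close> equality points, one for each pair of elements. For \<open>k = 0\<close> the
  function \<open>y\<close> is constant. For \<open>k = 1\<close> also
  \<open>T = 1\<close>, and the count is at most \<open>N\<close>. For \<open>k \<ge> 2\<close> one equality point has to be saved if every
  pair of elements ties in \<open>I\<close>. Then all other elements become lighter than the steepest one in turn,
  and at some of these ties the other element is not spanned by the elements that are at most as
  heavy as it is (\<open>neutral_exists\<close>). At such a tie no \<open>y\<^sub>F\<close> changes its optimal basis (\<open>min_base_steady\<close>), so no cut
  is needed there. Altogether \<open>y\<close> has at most \<open>(m choose 2) T\<close> changepoints, and
  \<open>T \<le> (k + l - 2 choose l - 1) k\<close>.\<close>

section \<open>Exchange properties of matroids\<close>

context matroid
begin

lemma finite_indep: "A \<in> \<F> \<Longrightarrow> finite A"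
  using indep_subset_ground finite_ground finite_subset by blast

lemma finite_family: "finite \<F>"
  by (rule finite_subset[of _ "Pow E"]) (use indep_subset_ground finite_ground in auto)

lemma card_le_rank: "A \<in> \<F> \<Longrightarrow> card A \<le> matroid_rank \<F>"
  unfolding matroid_rank_def using finite_family by simp

lemma extend_indep:
  assumes "A \<in> \<F>" "B \<in> \<F>" "card A \<le> card B"
  shows "\<exists>C\<in>\<F>. A \<subseteq> C \<and> C \<subseteq> A \<union> B \<and> card C = card B"
  using assms
proof (induction "card B - card A" arbitrary: A)
  case 0
  then show ?case by (intro bexI[of _ A]) auto
next
  case (Suc n)
  then have "card A < card B" by simp
  then obtain e where e: "e \<in> B - A" "insert e A \<in> \<F>"
    using augmentation[OF Suc.prems(1,2)] by blast
  then have "card (insert e A) = Suc (card A)"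
    using finite_indep[OF Suc.prems(1)] by simp
  then obtain C where "C \<in> \<F>" "insert e A \<subseteq> C" "C \<subseteq> insert e A \<union> B" "card C = card B"
    using Suc.hyps(1)[of "insert e A"] Suc.hyps(2) Suc.prems(2) e(2) \<open>card A < card B\<close>
    by (metis Suc_leI Suc_diff_Suc nat.inject)
  then show ?case using e(1) by blast
qed

text \<open>For \<^term>\<open>x \<in> E\<close> this set is the fundamental circuit of \<^term>\<open>x\<close> with respect to the
  basis \<^term>\<open>B\<close>.\<close>

lemma fundamental_circuit_dependent:
  assumes B: "B \<in> \<F>" "card B = matroid_rank \<F>" and x: "x \<notin> B"
  shows "insert x {y \<in> B. insert x (B - {y}) \<in> \<F>} \<notin> \<F>"
proof
  let ?A = "{y \<in> B. insert x (B - {y}) \<in> \<F>}"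
  assume A: "insert x ?A \<in> \<F>"
  then obtain C where C: "C \<in> \<F>" "insert x ?A \<subseteq> C" "C \<subseteq> insert x ?A \<union> B" "card C = card B"
    using extend_indep[OF A B(1)] card_le_rank[OF A] B(2) by auto
  have fin: "finite B" "finite C" using finite_indep B C by auto
  have "\<not> B \<subseteq> C"
    using card_subset_eq[of C B] C fin x by auto
  then obtain y where y: "y \<in> B" "y \<notin> C" by blast
  have "C \<subseteq> insert x (B - {y})" using C y by auto
  moreover have "card (insert x (B - {y})) = card C"
    using C(4) fin x y card_Suc_Diff1[of B y] by simp
  ultimately have "C = insert x (B - {y})"
    using card_subset_eq[of "insert x (B - {y})" C] fin by simp
  then have "y \<in> ?A" using C(1) y by simp
  then show False using C(2) y(2) by blast
qed

text \<open>If \<^term>\<open>x\<close> lies in the span of \<^term>\<open>A\<close>, then \<^term>\<open>x\<close> can be replaced in every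
  independent set by an element of \<^term>\<open>A\<close>.\<close>

lemma exchange_against_spanning:
  assumes A: "A \<in> \<F>" "insert x A \<notin> \<F>" and B: "B \<in> \<F>" "x \<in> B"
  shows "\<exists>y\<in>A - B. insert y (B - {x}) \<in> \<F>"
proof -
  have xA: "x \<notin> A" using A by (auto simp: insert_absorb)
  have Bx: "B - {x} \<in> \<F>" by (rule indep_subset[OF B(1)]) auto
  have cB: "card B = Suc (card (B - {x}))"
    using finite_indep[OF B(1)] B(2) card_Suc_Diff1[of B x] by simp
  have "\<exists>D\<in>\<F>. D \<subseteq> A \<union> (B - {x}) \<and> card (B - {x}) < card D"
  proof (cases "card A \<le> card (B - {x})")
    case True
    then obtain C where C: "C \<in> \<F>" "A \<subseteq> C" "C \<subseteq> A \<union> (B - {x})" "card C = card (B - {x})"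
      using extend_indep[OF A(1) Bx] by blast
    then obtain e where e: "e \<in> B - C" "insert e C \<in> \<F>"
      using augmentation[OF C(1) B(1)] cB by auto
    have "e \<noteq> x"
      using indep_subset[OF e(2), of "insert x A"] A(2) C(2) by blast
    then show ?thesis
      using C e finite_indep[OF C(1)] by (intro bexI[of _ "insert e C"]) auto
  next
    case False
    then show ?thesis using A(1) by (intro bexI[of _ A]) auto
  qed
  then obtain D where D: "D \<in> \<F>" "D \<subseteq> A \<union> (B - {x})" "card (B - {x}) < card D" by blast
  then obtain y where "y \<in> D - (B - {x})" "insert y (B - {x}) \<in> \<F>"
    using augmentation[OF Bx D(1)] by blast
  then show ?thesis using D(2) xA by blast
qed

lemma symmetric_exchange:
  assumes B: "B \<in> \<F>" "card B = matroid_rank \<F>" and B': "B' \<in> \<F>" and f: "f \<in> B' - B"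
  shows "\<exists>e\<in>B - B'. insert f (B - {e}) \<in> \<F> \<and> insert e (B' - {f}) \<in> \<F>"
proof -
  let ?A = "{y \<in> B. insert f (B - {y}) \<in> \<F>}"
  have "?A \<in> \<F>" by (rule indep_subset[OF B(1)]) auto
  moreover have "insert f ?A \<notin> \<F>"
    using fundamental_circuit_dependent[OF B] f by blast
  ultimately obtain e where "e \<in> ?A - B'" "insert e (B' - {f}) \<in> \<F>"
    using exchange_against_spanning[of ?A f B'] B' f by blast
  then show ?thesis by blast
qed

section \<open>Minimum weight bases\<close>

text \<open>The bases of the matroid that avoid \<^term>\<open>F\<close>. They are the bases of the restriction to
  the complement of \<^term>\<open>F\<close> as long as deleting \<^term>\<open>F\<close> preserves the rank.\<close>

definition bases_avoiding :: "'a set \<Rightarrow> 'a set set" where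
  "bases_avoiding F = {B \<in> \<F>. card B = matroid_rank \<F> \<and> B \<inter> F = {}}"

text \<open>Minimum weight bases among those that avoid \<^term>\<open>F\<close>; ties are not resolved.\<close>

definition min_base :: "('a \<Rightarrow> real) \<Rightarrow> 'a set \<Rightarrow> 'a set \<Rightarrow> bool" where
  "min_base w F B \<longleftrightarrow> B \<in> bases_avoiding F \<and> (\<forall>B'\<in>bases_avoiding F. sum w B \<le> sum w B')"

lemma min_base_exists:
  assumes "bases_avoiding F \<noteq> {}"
  shows "\<exists>B. min_base w F B"
proof -
  have "finite (bases_avoiding F)"
    by (rule finite_subset[OF _ finite_family]) (auto simp: bases_avoiding_def)
  then have "\<exists>B. is_arg_min (sum w) (\<lambda>B. B \<in> bases_avoiding F) B"
    using ex_is_arg_min_if_finite assms by blast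
  then show ?thesis
    unfolding is_arg_min_linorder min_base_def by blast
qed

lemma exchange_in_bases_avoiding:
  assumes "B \<in> bases_avoiding F" "e \<in> B" "f \<notin> B" "f \<notin> F" "insert f (B - {e}) \<in> \<F>"
  shows "insert f (B - {e}) \<in> bases_avoiding F"
proof -
  have "finite B" using assms finite_indep by (auto simp: bases_avoiding_def)
  then have "card (insert f (B - {e})) = card B"
    using assms card_Suc_Diff1[of B e] by simp
  then show ?thesis
    using assms by (auto simp: bases_avoiding_def)
qed

lemma sum_exchange:
  fixes w :: "'a \<Rightarrow> real"
  assumes "finite B" "e \<in> B" "f \<notin> B"
  shows "sum w (insert f (B - {e})) = sum w B - w e + w f"
  using assms by (simp add: sum_diff1)

lemma min_base_exchange_le:
  assumes "min_base w F B" "e \<in> B" "f \<notin> B" "f \<notin> F" "insert f (B - {e}) \<in> \<F>"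
  shows "w e \<le> w f"
proof -
  have B: "B \<in> bases_avoiding F" using assms by (simp add: min_base_def)
  then have "finite B" using finite_indep by (auto simp: bases_avoiding_def)
  moreover have "sum w B \<le> sum w (insert f (B - {e}))"
    using exchange_in_bases_avoiding[OF B assms(2-)] assms(1) by (simp add: min_base_def)
  ultimately show ?thesis using sum_exchange[of B e f w] assms by simp
qed

lemma locally_min_imp_min_base:
  assumes B: "B \<in> bases_avoiding F"
    and loc: "\<And>e f. e \<in> B \<Longrightarrow> f \<in> E - B - F \<Longrightarrow> insert f (B - {e}) \<in> \<F> \<Longrightarrow> w e \<le> w f"
  shows "min_base w F B"
proof -
  have B1: "B \<in> \<F>" "card B = matroid_rank \<F>" "B \<inter> F = {}"
    using B by (auto simp: bases_avoiding_def)
  have "sum w B \<le> sum w B'" if "B' \<in> bases_avoiding F" for B'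
    using that
  proof (induction "card (B' - B)" arbitrary: B')
    case 0
    have B': "B' \<in> \<F>" "card B' = card B"
      using 0 B1 by (auto simp: bases_avoiding_def)
    have "B' \<subseteq> B" using 0 finite_indep[OF B'(1)] by auto
    then have "B' = B" using card_subset_eq[OF finite_indep[OF B1(1)]] B' by simp
    then show ?case by simp
  next
    case (Suc n)
    have B': "B' \<in> \<F>" "B' \<inter> F = {}"
      using Suc.prems by (auto simp: bases_avoiding_def)
    have fin: "finite B'" by (rule finite_indep[OF B'(1)])
    obtain f where f: "f \<in> B' - B"
      using Suc.hyps(2) by (metis card.empty equals0I nat.distinct(1))
    obtain e where e: "e \<in> B - B'" "insert f (B - {e}) \<in> \<F>" "insert e (B' - {f}) \<in> \<F>"
      using symmetric_exchange[OF B1(1,2) B'(1) f] by blast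
    have "w e \<le> w f"
      using loc[of e f] e f B' indep_subset_ground by blast
    moreover have "insert e (B' - {f}) \<in> bases_avoiding F"
      using exchange_in_bases_avoiding[OF Suc.prems, of f e] e f B1(3) by blast
    moreover have "n = card (insert e (B' - {f}) - B)"
    proof -
      have "insert e (B' - {f}) - B = (B' - B) - {f}" using e by blast
      then show ?thesis using Suc.hyps(2) f fin by simp
    qed
    ultimately have "sum w B \<le> sum w (insert e (B' - {f}))"
      using Suc.hyps(1) by blast
    also have "\<dots> = sum w B' - w f + w e"
      using sum_exchange[of B' f e w] fin e f by blast
    finally show ?case using \<open>w e \<le> w f\<close> by simp
  qed
  then show ?thesis using B by (simp add: min_base_def)
qed

text \<open>Deleting \<^term>\<open>e\<close> only removes \<^term>\<open>e\<close> from the minimum weight basis: an element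
  \<^term>\<open>x\<close> that left it as well would be spanned by lighter elements.\<close>

lemma min_base_insert_superset:
  assumes inj: "inj_on w E"
    and B: "min_base w F B" and B': "min_base w (insert e F) B'"
  shows "B - {e} \<subseteq> B'"
proof
  fix x assume x: "x \<in> B - {e}"
  have B1: "B \<in> \<F>" "B \<inter> F = {}"
    and B'1: "B' \<in> \<F>" "card B' = matroid_rank \<F>" "B' \<inter> insert e F = {}"
    using B B' by (auto simp: bases_avoiding_def min_base_def)
  show "x \<in> B'"
  proof (rule ccontr)
    assume xB': "x \<notin> B'"
    let ?A = "{y \<in> B'. insert x (B' - {y}) \<in> \<F>}"
    have "?A \<in> \<F>" by (rule indep_subset[OF B'1(1)]) auto
    moreover have "insert x ?A \<notin> \<F>"
      by (rule fundamental_circuit_dependent[OF B'1(1,2) xB'])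
    ultimately obtain y where y: "y \<in> ?A - B" "insert y (B - {x}) \<in> \<F>"
      using exchange_against_spanning[OF _ _ B1(1), of ?A x] x by blast
    have "w y \<le> w x"
      by (rule min_base_exchange_le[OF B']) (use x xB' y B1 in auto)
    moreover have "w x \<le> w y"
      by (rule min_base_exchange_le[OF B]) (use x y B'1 in auto)
    ultimately have "x = y"
      using inj x y B1(1) B'1(1) indep_subset_ground
      by (metis (no_types, lifting) DiffE antisym inj_onD mem_Collect_eq subsetD)
    then show False using xB' y by blast
  qed
qed

lemma min_base_weight_le:
  assumes "min_base w F B" "min_base w F\<^sub>0 B\<^sub>0" "min_base w F' B'" "B\<^sub>0 \<inter> F = {}" "F\<^sub>0 \<subseteq> F'"
  shows "sum w B \<le> sum w B'"
proof -
  have "B\<^sub>0 \<in> bases_avoiding F" "B' \<in> bases_avoiding F\<^sub>0"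
    using assms by (auto simp: min_base_def bases_avoiding_def)
  then have "sum w B \<le> sum w B\<^sub>0" "sum w B\<^sub>0 \<le> sum w B'"
    using assms(1,2) by (auto simp: min_base_def)
  then show ?thesis by simp
qed

section \<open>Candidate interdiction sets\<close>

text \<open>Branching on an element \<^term>\<open>e\<close> of the current optimal basis \<^term>\<open>\<beta> F\<^sub>0\<close>: either
  \<^term>\<open>e\<close> is interdicted too, or it is kept forever and joins \<^term>\<open>K\<close>. The parameter
  \<^term>\<open>j\<close> counts the basis elements not yet kept and \<^term>\<open>n\<close> the interdictions left, so
  the number of candidates obeys Pascal's rule. Sets that avoid the current basis do not increase
  the value beyond that of \<^term>\<open>F\<^sub>0\<close> and are dominated by any candidate.\<close>

lemma candidates_branching:
  fixes w :: "real \<Rightarrow> 'a \<Rightarrow> real"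
  assumes \<beta>: "\<And>F t. F \<subseteq> E \<Longrightarrow> card F \<le> l \<Longrightarrow> t \<in> J \<Longrightarrow> min_base (w t) F (\<beta> F)"
    and s: "s \<in> J" "inj_on (w s) E"
    and "F\<^sub>0 \<subseteq> E" "card F\<^sub>0 + n = l" "K \<subseteq> \<beta> F\<^sub>0" "card K + j = matroid_rank \<F>"
  shows "\<exists>C. finite C \<and> card C \<le> (j + n - 1) choose n \<and> (j > 0 \<or> n = 0 \<longrightarrow> C \<noteq> {}) \<and>
    (\<forall>F'\<in>C. F\<^sub>0 \<subseteq> F' \<and> F' \<subseteq> E \<and> card F' = l) \<and>
    (\<forall>F. F\<^sub>0 \<subseteq> F \<and> F \<subseteq> E \<and> card F = l \<and> F \<inter> K = {} \<longrightarrow>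
      \<beta> F\<^sub>0 \<inter> F = {} \<or> (\<exists>F'\<in>C. \<forall>t\<in>J. sum (w t) (\<beta> F) \<le> sum (w t) (\<beta> F')))"
  using assms(4-)
proof (induction n arbitrary: F\<^sub>0 K j)
  case 0
  have "F = F\<^sub>0" if "F\<^sub>0 \<subseteq> F" "F \<subseteq> E" "card F = l" for F
    using card_subset_eq[of F F\<^sub>0] that 0 finite_subset[OF _ finite_ground] by auto
  then have "\<forall>F. F\<^sub>0 \<subseteq> F \<and> F \<subseteq> E \<and> card F = l \<and> F \<inter> K = {} \<longrightarrow>
      \<beta> F\<^sub>0 \<inter> F = {} \<or> (\<exists>F'\<in>{F\<^sub>0}. \<forall>t\<in>J. sum (w t) (\<beta> F) \<le> sum (w t) (\<beta> F'))"
    by blast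
  then show ?case using 0 by (intro exI[of _ "{F\<^sub>0}"] conjI impI) simp_all
next
  case (Suc n)
  note IH = Suc.IH and F\<^sub>0 = Suc.prems(1,2)
  have \<beta>0: "\<beta> F\<^sub>0 \<in> bases_avoiding F\<^sub>0"
    using \<beta>[of F\<^sub>0 s] Suc.prems s by (auto simp: min_base_def)
  then have fin: "finite (\<beta> F\<^sub>0)" and card: "card (\<beta> F\<^sub>0) = matroid_rank \<F>"
    and disj: "\<beta> F\<^sub>0 \<inter> F\<^sub>0 = {}" and sub: "\<beta> F\<^sub>0 \<subseteq> E"
    using finite_indep indep_subset_ground by (auto simp: bases_avoiding_def)
  show ?case
    using Suc.prems(3,4)
  proof (induction j arbitrary: K)
    case 0
    then have "K = \<beta> F\<^sub>0" using card_subset_eq[OF fin] card by simp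
    then show ?case by (intro exI[of _ "{}"] conjI impI) (simp_all, blast)
  next
    case (Suc j)
    have finK: "finite K" using Suc.prems fin finite_subset by blast
    have "\<not> \<beta> F\<^sub>0 \<subseteq> K" using card_mono[OF finK, of "\<beta> F\<^sub>0"] Suc.prems card by auto
    then obtain e where e: "e \<in> \<beta> F\<^sub>0" "e \<notin> K" by blast
    have eF: "e \<notin> F\<^sub>0" "e \<in> E" using e disj sub by auto
    have F0: "insert e F\<^sub>0 \<subseteq> E" "card (insert e F\<^sub>0) + n = l"
      using eF F\<^sub>0 finite_subset[OF _ finite_ground] by auto
    have "\<beta> F\<^sub>0 - {e} \<subseteq> \<beta> (insert e F\<^sub>0)"
      by (rule min_base_insert_superset[OF s(2), of F\<^sub>0 _ e])
        (use \<beta>[of F\<^sub>0 s] \<beta>[of "insert e F\<^sub>0" s] F\<^sub>0 F0 s in auto)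
    then have "K \<subseteq> \<beta> (insert e F\<^sub>0)" using e Suc.prems by blast
    note C = IH[OF F0 this Suc.prems(2)]
    obtain C1 where C1: "finite C1" "card C1 \<le> (Suc j + n - 1) choose n"
      "Suc j > 0 \<or> n = 0 \<longrightarrow> C1 \<noteq> {}"
      "\<forall>F'\<in>C1. insert e F\<^sub>0 \<subseteq> F' \<and> F' \<subseteq> E \<and> card F' = l"
      and C1': "\<forall>F. insert e F\<^sub>0 \<subseteq> F \<and> F \<subseteq> E \<and> card F = l \<and> F \<inter> K = {} \<longrightarrow>
        \<beta> (insert e F\<^sub>0) \<inter> F = {} \<or> (\<exists>F'\<in>C1. \<forall>t\<in>J. sum (w t) (\<beta> F) \<le> sum (w t) (\<beta> F'))"
      using C by (elim exE conjE) (rule that)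
    have "card (insert e K) + j = matroid_rank \<F>" "insert e K \<subseteq> \<beta> F\<^sub>0"
      using Suc.prems e finK by auto
    note C = Suc.IH[OF this(2,1)]
    obtain C2 where C2: "finite C2" "card C2 \<le> (j + Suc n - 1) choose Suc n"
      "\<forall>F'\<in>C2. F\<^sub>0 \<subseteq> F' \<and> F' \<subseteq> E \<and> card F' = l"
      and C2': "\<forall>F. F\<^sub>0 \<subseteq> F \<and> F \<subseteq> E \<and> card F = l \<and> F \<inter> insert e K = {} \<longrightarrow>
        \<beta> F\<^sub>0 \<inter> F = {} \<or> (\<exists>F'\<in>C2. \<forall>t\<in>J. sum (w t) (\<beta> F) \<le> sum (w t) (\<beta> F'))"
      using C by (elim exE conjE) (rule that)
    have dom: "\<beta> F\<^sub>0 \<inter> F = {} \<or> (\<exists>F'\<in>C1 \<union> C2. \<forall>t\<in>J. sum (w t) (\<beta> F) \<le> sum (w t) (\<beta> F'))"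
      if F: "F\<^sub>0 \<subseteq> F" "F \<subseteq> E" "card F = l" "F \<inter> K = {}" for F
    proof (cases "e \<in> F")
      case False
      then show ?thesis using C2' F by blast
    next
      case True
      then consider "\<beta> (insert e F\<^sub>0) \<inter> F = {}"
        | "\<exists>F'\<in>C1. \<forall>t\<in>J. sum (w t) (\<beta> F) \<le> sum (w t) (\<beta> F')"
        using C1' F by blast
      then show ?thesis
      proof cases
        case 1
        obtain F' where F': "F' \<in> C1" using C1(3) by blast
        have "sum (w t) (\<beta> F) \<le> sum (w t) (\<beta> F')" if t: "t \<in> J" for t
        proof -
          have m: "min_base (w t) F (\<beta> F)" "min_base (w t) F' (\<beta> F')"
            "min_base (w t) (insert e F\<^sub>0) (\<beta> (insert e F\<^sub>0))"
            using \<beta> F F' C1(4) F0 t by auto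
          show ?thesis
            by (rule min_base_weight_le[OF m(1,3,2)]) (use 1 C1(4) F' in auto)
        qed
        then show ?thesis using F' by blast
      qed blast
    qed
    have "\<forall>F. F\<^sub>0 \<subseteq> F \<and> F \<subseteq> E \<and> card F = l \<and> F \<inter> K = {} \<longrightarrow>
      \<beta> F\<^sub>0 \<inter> F = {} \<or> (\<exists>F'\<in>C1 \<union> C2. \<forall>t\<in>J. sum (w t) (\<beta> F) \<le> sum (w t) (\<beta> F'))"
      using dom by blast
    moreover have "card (C1 \<union> C2) \<le> (Suc j + Suc n - 1) choose Suc n"
      using C1(2) C2(2) card_Un_le[of C1 C2] by simp
    moreover have "finite (C1 \<union> C2)" "C1 \<union> C2 \<noteq> {}"
      "\<forall>F'\<in>C1 \<union> C2. F\<^sub>0 \<subseteq> F' \<and> F' \<subseteq> E \<and> card F' = l"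
      using C1(1,3,4) C2(1,3) by auto
    ultimately show ?case
      by (intro exI[of _ "C1 \<union> C2"] conjI impI)
  qed
qed

lemma candidates:
  fixes w :: "real \<Rightarrow> 'a \<Rightarrow> real"
  assumes \<beta>: "\<And>F t. F \<subseteq> E \<Longrightarrow> card F \<le> l \<Longrightarrow> t \<in> J \<Longrightarrow> min_base (w t) F (\<beta> F)"
    and s: "s \<in> J" "inj_on (w s) E"
    and k: "matroid_rank \<F> > 0"
  shows "\<exists>C. finite C \<and> C \<noteq> {} \<and> card C \<le> (matroid_rank \<F> + l - 1) choose l \<and>
    (\<forall>F'\<in>C. F' \<subseteq> E \<and> card F' = l) \<and>
    (\<forall>F. F \<subseteq> E \<and> card F = l \<longrightarrow> (\<exists>F'\<in>C. \<forall>t\<in>J. sum (w t) (\<beta> F) \<le> sum (w t) (\<beta> F')))"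
proof -
  have "\<exists>C. finite C \<and> card C \<le> (matroid_rank \<F> + l - 1) choose l \<and>
    (matroid_rank \<F> > 0 \<or> l = 0 \<longrightarrow> C \<noteq> {}) \<and>
    (\<forall>F'\<in>C. {} \<subseteq> F' \<and> F' \<subseteq> E \<and> card F' = l) \<and>
    (\<forall>F. {} \<subseteq> F \<and> F \<subseteq> E \<and> card F = l \<and> F \<inter> {} = {} \<longrightarrow>
      \<beta> {} \<inter> F = {} \<or> (\<exists>F'\<in>C. \<forall>t\<in>J. sum (w t) (\<beta> F) \<le> sum (w t) (\<beta> F')))"
    by (rule candidates_branching[where w = w and J = J and s = s]) (use \<beta> s in auto)
  then obtain C where C: "finite C" "card C \<le> (matroid_rank \<F> + l - 1) choose l"
    "matroid_rank \<F> > 0 \<or> l = 0 \<longrightarrow> C \<noteq> {}"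
    "\<forall>F'\<in>C. {} \<subseteq> F' \<and> F' \<subseteq> E \<and> card F' = l"
    and C': "\<forall>F. {} \<subseteq> F \<and> F \<subseteq> E \<and> card F = l \<and> F \<inter> {} = {} \<longrightarrow>
      \<beta> {} \<inter> F = {} \<or> (\<exists>F'\<in>C. \<forall>t\<in>J. sum (w t) (\<beta> F) \<le> sum (w t) (\<beta> F'))"
    by (elim exE conjE) (rule that)
  have "\<exists>F'\<in>C. \<forall>t\<in>J. sum (w t) (\<beta> F) \<le> sum (w t) (\<beta> F')" if F: "F \<subseteq> E" "card F = l" for F
  proof (cases "\<beta> {} \<inter> F = {}")
    case True
    obtain F' where F': "F' \<in> C" using C(3) k by blast
    have "sum (w t) (\<beta> F) \<le> sum (w t) (\<beta> F')" if t: "t \<in> J" for t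
    proof -
      have m: "min_base (w t) F (\<beta> F)" "min_base (w t) F' (\<beta> F')" "min_base (w t) {} (\<beta> {})"
        using \<beta> F F' C(4) t by auto
      show ?thesis
        by (rule min_base_weight_le[OF m(1,3,2)]) (use True in auto)
    qed
    then show ?thesis using F' by blast
  qed (use C' F in blast)
  then have "\<forall>F. F \<subseteq> E \<and> card F = l \<longrightarrow>
      (\<exists>F'\<in>C. \<forall>t\<in>J. sum (w t) (\<beta> F) \<le> sum (w t) (\<beta> F'))"
    by blast
  moreover have "C \<noteq> {}" "\<forall>F'\<in>C. F' \<subseteq> E \<and> card F' = l"
    using C(3,4) k by auto
  ultimately show ?thesis using C(1,2) by (intro exI[of _ C] conjI)
qed

end

section \<open>Changepoints of upper envelopes\<close>

text \<open>On both sides of a changepoint the envelope follows functions of different slopes, and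
  slopes of attaining functions do not decrease with the parameter. So the largest slope attained at a
  changepoint determines the changepoint, and it is never the least slope of all.\<close>

lemma changepoints_Max_affine:
  fixes \<alpha> \<beta> :: "'c \<Rightarrow> real"
  assumes C: "finite C" "C \<noteq> {}"
    and y: "\<And>t. t \<in> J \<Longrightarrow> y t = Max ((\<lambda>c. \<alpha> c + \<beta> c * t) ` C)"
  shows "finite (changepoints J y) \<and> card (changepoints J y) + 1 \<le> card C"
proof -
  define active where "active t = {c \<in> C. \<alpha> c + \<beta> c * t = y t}" for t
  have le: "\<alpha> c + \<beta> c * t \<le> y t" if "c \<in> C" "t \<in> J" for c t
    using that C y[of t] by simp
  have fin: "finite (active t)" for t using C by (simp add: active_def)
  have ne: "active t \<noteq> {}" if "t \<in> J" for t
  proof -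
    have "y t \<in> (\<lambda>c. \<alpha> c + \<beta> c * t) ` C"
      unfolding y[OF that] by (rule Max_in) (use C in auto)
    then show ?thesis by (auto simp: active_def)
  qed
  have two: "\<exists>c\<in>active t. \<exists>d\<in>active t. \<beta> c < \<beta> d" if t: "t \<in> changepoints J y" for t
  proof (rule ccontr)
    assume no: "\<not> ?thesis"
    have tJ: "t \<in> J" using t by (simp add: changepoints_def)
    obtain c\<^sub>0 where c0: "c\<^sub>0 \<in> active t" using ne[OF tJ] by blast
    have same: "\<beta> c = \<beta> c\<^sub>0" if "c \<in> active t" for c
      using no that c0 by (meson linorder_neqE)
    have "\<forall>\<^sub>F x in at t within J. \<alpha> c + \<beta> c * x \<le> y t + \<beta> c\<^sub>0 * (x - t)" if c: "c \<in> C" for c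
    proof (cases "c \<in> active t")
      case True
      then have "\<alpha> c + \<beta> c * x = y t + \<beta> c\<^sub>0 * (x - t)" for x
        using same[OF True] by (simp add: active_def algebra_simps)
      then show ?thesis by simp
    next
      case False
      then have "\<alpha> c + \<beta> c * t < y t"
        using le[OF c tJ] c by (auto simp: active_def)
      moreover have "((\<lambda>x. y t + \<beta> c\<^sub>0 * (x - t) - (\<alpha> c + \<beta> c * x)) \<longlongrightarrow>
          y t + \<beta> c\<^sub>0 * (t - t) - (\<alpha> c + \<beta> c * t)) (at t within J)"
        by (intro tendsto_intros)
      ultimately have "\<forall>\<^sub>F x in at t within J. 0 < y t + \<beta> c\<^sub>0 * (x - t) - (\<alpha> c + \<beta> c * x)"
        by (intro order_tendstoD(1)) auto
      then show ?thesis by eventually_elim simp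
    qed
    then have "\<forall>\<^sub>F x in at t within J. \<forall>c\<in>C. \<alpha> c + \<beta> c * x \<le> y t + \<beta> c\<^sub>0 * (x - t)"
      using C(1) by (simp add: eventually_ball_finite)
    moreover have "\<forall>\<^sub>F x in at t within J. x \<in> J"
      by (simp add: eventually_at_filter)
    ultimately have "\<forall>\<^sub>F x in at t within J. y x = y t + \<beta> c\<^sub>0 * (x - t)"
    proof eventually_elim
      case (elim x)
      have "y x \<le> y t + \<beta> c\<^sub>0 * (x - t)"
        using elim C y[of x] by simp
      moreover have "\<alpha> c\<^sub>0 + \<beta> c\<^sub>0 * x \<le> y x"
        using le c0 elim by (auto simp: active_def)
      moreover have "\<alpha> c\<^sub>0 + \<beta> c\<^sub>0 * x = y t + \<beta> c\<^sub>0 * (x - t)"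
        using c0 by (simp add: active_def algebra_simps)
      ultimately show ?case by simp
    qed
    then show False using t by (auto simp: changepoints_def)
  qed
  have mono: "\<beta> c \<le> \<beta> d" if "t \<in> J" "t' \<in> J" "t < t'" "c \<in> active t" "d \<in> active t'" for t t' c d
  proof -
    have "\<alpha> d + \<beta> d * t \<le> \<alpha> c + \<beta> c * t" "\<alpha> c + \<beta> c * t' \<le> \<alpha> d + \<beta> d * t'"
      using le that by (auto simp: active_def)
    then have "0 \<le> (\<beta> d - \<beta> c) * (t' - t)" by (simp add: algebra_simps)
    then show ?thesis using that(3) by (simp add: zero_le_mult_iff)
  qed
  define hi where "hi t = Max (\<beta> ` active t)" for t
  have hi_ge: "\<beta> c \<le> hi t" if "c \<in> active t" for c t
    using that fin by (simp add: hi_def)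
  have hi_less: "hi t < hi t'"
    if t: "t \<in> changepoints J y" "t' \<in> changepoints J y" "t < t'" for t t'
  proof -
    have J: "t \<in> J" "t' \<in> J" using t by (auto simp: changepoints_def)
    obtain c d where cd: "c \<in> active t'" "d \<in> active t'" "\<beta> c < \<beta> d" using two[OF t(2)] by blast
    have "hi t \<le> \<beta> c"
      unfolding hi_def using mono[OF J t(3) _ cd(1)] fin ne[OF J(1)] by simp
    then show ?thesis using cd hi_ge[OF cd(2)] by simp
  qed
  then have inj: "inj_on hi (changepoints J y)"
    by (intro linorder_inj_onI) (auto, force)
  have "hi ` changepoints J y \<subseteq> \<beta> ` C - {Min (\<beta> ` C)}"
  proof
    fix z assume "z \<in> hi ` changepoints J y"
    then obtain t where t: "t \<in> changepoints J y" "z = hi t" by blast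
    obtain c d where cd: "c \<in> active t" "d \<in> active t" "\<beta> c < \<beta> d" using two[OF t(1)] by blast
    have "hi t \<in> \<beta> ` active t" unfolding hi_def by (rule Max_in) (use fin cd in auto)
    moreover have "Min (\<beta> ` C) \<le> \<beta> c" using C cd by (auto simp: active_def)
    ultimately show "z \<in> \<beta> ` C - {Min (\<beta> ` C)}"
      using cd hi_ge[OF cd(2)] t by (auto simp: active_def)
  qed
  moreover have fin': "finite (\<beta> ` C - {Min (\<beta> ` C)})" using C by simp
  ultimately have finite: "finite (changepoints J y)"
    and card: "card (changepoints J y) \<le> card (\<beta> ` C - {Min (\<beta> ` C)})"
    using card_inj_on_le[OF inj] inj_on_finite[OF inj] by auto
  note card
  also have "card (\<beta> ` C - {Min (\<beta> ` C)}) = card (\<beta> ` C) - 1"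
    using C by simp
  also have "\<dots> \<le> card C - 1" using card_image_le[OF C(1), of \<beta>] by simp
  finally show ?thesis using finite C card_gt_0_iff[of C] by simp
qed

lemma changepoints_const: "changepoints I (\<lambda>_. c) = {}"
  by (auto simp: changepoints_def intro!: exI[of _ 0])

text \<open>Cutting an interval at the points of \<^term>\<open>P\<close> leaves at most \<^term>\<open>card P + 1\<close> intervals,
  indexed by the number of points of \<^term>\<open>P\<close> below them.\<close>

lemma changepoints_split:
  fixes y :: "real \<Rightarrow> real"
  assumes I: "is_interval I" and P: "finite P"
    and piece: "\<And>J. J \<subseteq> I \<Longrightarrow> is_interval J \<Longrightarrow> J \<inter> P = {} \<Longrightarrow>
      finite (changepoints J y) \<and> card (changepoints J y) \<le> n"
  shows "finite (changepoints I y) \<and> card (changepoints I y) \<le> card P + (card P + 1) * n"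
proof -
  define below where "below x = {\<tau> \<in> P. \<tau> < x}" for x
  define J where "J i = {x \<in> I - P. card (below x) = i}" for i
  have fin: "finite (below x)" for x using P by (simp add: below_def)
  have int: "is_interval (J i)" for i
    unfolding is_interval_1
  proof (intro ballI allI impI)
    fix u v x assume uv: "u \<in> J i" "v \<in> J i" and x: "u \<le> x \<and> x \<le> v"
    have sub: "below u \<subseteq> below x" "below x \<subseteq> below v" using x by (auto simp: below_def)
    have "card (below u) = i" "card (below v) = i" using uv by (auto simp: J_def)
    moreover have "card (below u) \<le> card (below x)" "card (below x) \<le> card (below v)"
      using sub fin by (auto intro: card_mono)
    ultimately have c: "card (below x) = i" by simp
    have "below u = below v"
      using card_subset_eq[OF fin, of "below u" v] sub \<open>card (below u) = i\<close> \<open>card (below v) = i\<close>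
      by auto
    have "x \<notin> P"
    proof
      assume "x \<in> P"
      then have "x \<noteq> v" using uv by (auto simp: J_def)
      then have "x \<in> below v" using \<open>x \<in> P\<close> x by (simp add: below_def)
      then have "x < u" using \<open>below u = below v\<close> by (auto simp: below_def)
      then show False using x by simp
    qed
    moreover have "x \<in> I" using I uv x unfolding is_interval_1 J_def by blast
    ultimately show "x \<in> J i" using c by (simp add: J_def)
  qed
  have sub: "changepoints I y \<subseteq> P \<union> (\<Union>i\<le>card P. changepoints (J i) y)"
  proof
    fix t assume t: "t \<in> changepoints I y"
    show "t \<in> P \<union> (\<Union>i\<le>card P. changepoints (J i) y)"
    proof (cases "t \<in> P")
      case False
      define i where "i = card (below t)"
      have tI: "t \<in> I" using t by (simp add: changepoints_def)
      have i: "i \<le> card P" unfolding i_def by (rule card_mono[OF P]) (auto simp: below_def)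
      have "open (- P)" using P by (simp add: finite_imp_closed open_Compl)
      then obtain e where e: "e > 0" "ball t e \<subseteq> - P"
        using False by (meson ComplI openE)
      have "x \<in> J i" if x: "x \<in> I \<inter> ball t e" for x
      proof -
        have "below x = below t"
        proof -
          have "\<tau> < x \<longleftrightarrow> \<tau> < t" if "\<tau> \<in> P" for \<tau>
          proof -
            have "\<not> dist t \<tau> < e" using e that by auto
            then show ?thesis using x by (auto simp: dist_real_def)
          qed
          then show ?thesis by (auto simp: below_def)
        qed
        then show ?thesis using x e by (auto simp: J_def i_def)
      qed
      then have "J i \<inter> ball t e - {t} = I \<inter> ball t e - {t}" by (auto simp: J_def)
      then have "at t within J i = at t within I"
        using e(1) by (intro at_within_nhd[of t "ball t e"]) auto
      moreover have "t \<in> J i" using tI False by (simp add: J_def i_def)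
      ultimately have "t \<in> changepoints (J i) y" using t by (simp add: changepoints_def)
      then show ?thesis using i by blast
    qed simp
  qed
  have J: "finite (changepoints (J i) y) \<and> card (changepoints (J i) y) \<le> n" for i
    by (rule piece[OF _ int]) (auto simp: J_def)
  have finU: "finite (P \<union> (\<Union>i\<le>card P. changepoints (J i) y))" using P J by simp
  have "card (changepoints I y) \<le> card (P \<union> (\<Union>i\<le>card P. changepoints (J i) y))"
    by (rule card_mono[OF finU sub])
  also have "\<dots> \<le> card P + card (\<Union>i\<le>card P. changepoints (J i) y)" by (rule card_Un_le)
  also have "card (\<Union>i\<le>card P. changepoints (J i) y) \<le> (\<Sum>i\<le>card P. card (changepoints (J i) y))"
    by (rule card_UN_le) simp
  also have "\<dots> \<le> (\<Sum>i\<le>card P. n)" by (rule sum_mono) (use J in simp)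
  finally show ?thesis using finite_subset[OF sub finU] by simp
qed

section \<open>Equality points\<close>

lemma weight_crossing:
  assumes "weight a b e s \<le> weight a b f s" "weight a b f t < weight a b e t"
  shows "\<exists>\<tau>\<in>closed_segment s t. \<tau> \<noteq> t \<and> weight a b e \<tau> = weight a b f \<tau>"
proof -
  define d where "d u = weight a b f u - weight a b e u" for u
  define u where "u = d s / (d s - d t)"
  define \<tau> where "\<tau> = (1 - u) * s + u * t"
  have ds: "d s \<ge> 0" "d t < 0" using assms by (auto simp: d_def)
  then have u: "0 \<le> u" "u \<le> 1" "u * (d s - d t) = d s"
    by (auto simp: u_def divide_simps)
  have "d \<tau> = (1 - u) * d s + u * d t"
    unfolding d_def weight_def \<tau>_def by (simp add: algebra_simps)
  also have "\<dots> = 0" using u(3) by (simp add: algebra_simps)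
  finally have "d \<tau> = 0" .
  moreover have "\<tau> \<in> closed_segment s t"
    unfolding closed_segment_def \<tau>_def using u by auto
  ultimately show ?thesis using ds(2) by (intro bexI[of _ \<tau>]) (auto simp: d_def)
qed

lemma weight_eq_twice:
  assumes "weight a b e t = weight a b f t" "weight a b e t' = weight a b f t'" "t \<noteq> t'"
  shows "weight a b e = weight a b f"
proof -
  have "(t - t') * (of_rat (b e) - of_rat (b f)) = (0::real)"
    using assms(1,2) by (simp add: weight_def algebra_simps)
  then have "(of_rat (b e) :: real) = of_rat (b f)" using assms(3) by simp
  moreover from this have "(of_rat (a e) :: real) = of_rat (a f)"
    using assms(1) by (simp add: weight_def)
  ultimately show ?thesis by (intro ext) (simp add: weight_def)
qed

text \<open>A matroid with affine weights that stays of full rank after the deletion of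
  \<^term>\<open>l\<close> elements; the weight functions are distinct, and no two different pairs of elements tie
  at the same parameter in \<^term>\<open>I\<close>.\<close>

locale parametric_interdiction = matroid E \<F> for E :: "'a set" and \<F> +
  fixes a b :: "'a \<Rightarrow> rat" and I :: "real set" and l :: nat
  assumes interval: "is_interval I"
    and l_le_card: "l \<le> card E"
    and rank_deletion: "F \<subseteq> E \<Longrightarrow> card F = l \<Longrightarrow> bases_avoiding F \<noteq> {}"
    and unique_tie: "t \<in> I \<Longrightarrow> {e, f, g, h} \<subseteq> E \<Longrightarrow> e \<noteq> f \<Longrightarrow> g \<noteq> h \<Longrightarrow>
      weight a b e t = weight a b f t \<Longrightarrow> weight a b g t = weight a b h t \<Longrightarrow> {e, f} = {g, h}"
    and weights_distinct: "e \<in> E \<Longrightarrow> f \<in> E \<Longrightarrow> e \<noteq> f \<Longrightarrow> weight a b e \<noteq> weight a b f"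
begin

text \<open>The equality points: the parameters at which two elements tie.\<close>

definition eq_points :: "real set" where
  "eq_points = {t \<in> I. \<exists>e\<in>E. \<exists>f\<in>E. e \<noteq> f \<and> weight a b e t = weight a b f t}"

text \<open>Two elements with distinct weight functions tie at most once, so a tying pair determines its
  equality point.\<close>

lemma eq_points_inj_pairs:
  "\<exists>S. inj_on S eq_points \<and> S ` eq_points \<subseteq> {S. S \<subseteq> E \<and> card S = 2} \<and>
    (\<forall>t\<in>eq_points. \<forall>e\<in>S t. \<forall>f\<in>S t. weight a b e t = weight a b f t)"
proof -
  have "\<exists>S. S \<subseteq> E \<and> card S = 2 \<and> (\<forall>e\<in>S. \<forall>f\<in>S. weight a b e t = weight a b f t)"
    if t: "t \<in> eq_points" for t
  proof -
    obtain e f where "e \<in> E" "f \<in> E" "e \<noteq> f" "weight a b e t = weight a b f t"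
      using t by (auto simp: eq_points_def)
    then show ?thesis by (intro exI[of _ "{e, f}"]) auto
  qed
  then have "\<forall>t\<in>eq_points. \<exists>S. S \<subseteq> E \<and> card S = 2 \<and>
      (\<forall>e\<in>S. \<forall>f\<in>S. weight a b e t = weight a b f t)"
    by (intro ballI)
  from bchoice[OF this] obtain S where "\<forall>t\<in>eq_points. S t \<subseteq> E \<and> card (S t) = 2 \<and>
      (\<forall>e\<in>S t. \<forall>f\<in>S t. weight a b e t = weight a b f t)" ..
  then have S: "S t \<subseteq> E" "card (S t) = 2" "\<forall>e\<in>S t. \<forall>f\<in>S t. weight a b e t = weight a b f t"
    if "t \<in> eq_points" for t
    using that by blast+
  have "inj_on S eq_points"
  proof (rule inj_onI, rule ccontr)
    fix t t' assume t: "t \<in> eq_points" "t' \<in> eq_points" "S t = S t'" "t \<noteq> t'"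
    obtain e f where ef: "S t = {e, f}" "e \<noteq> f" using S(2)[OF t(1)] by (auto simp: card_2_iff)
    then have "weight a b e t = weight a b f t" "weight a b e t' = weight a b f t'"
      using S(3)[OF t(1)] S(3)[OF t(2)] t(3) by blast+
    then have "weight a b e = weight a b f" using t(4) by (rule weight_eq_twice)
    then show False using weights_distinct[of e f] S(1)[OF t(1)] ef by blast
  qed
  moreover have "S ` eq_points \<subseteq> {S. S \<subseteq> E \<and> card S = 2}" using S(1,2) by blast
  moreover have "\<forall>t\<in>eq_points. \<forall>e\<in>S t. \<forall>f\<in>S t. weight a b e t = weight a b f t"
    using S(3) by blast
  ultimately show ?thesis by (intro exI[of _ S] conjI)
qed

lemma finite_pairs: "finite {S. S \<subseteq> E \<and> card S = 2}"
  by (rule finite_subset[of _ "Pow E"]) (use finite_ground in auto)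

lemma eq_points_card: "finite eq_points" "card eq_points \<le> card E choose 2"
proof -
  obtain S where S: "inj_on S eq_points" "S ` eq_points \<subseteq> {S. S \<subseteq> E \<and> card S = 2}"
    using eq_points_inj_pairs by (elim exE conjE)
  show "finite eq_points" by (rule inj_on_finite[OF S finite_pairs])
  show "card eq_points \<le> card E choose 2"
    using card_inj_on_le[OF S finite_pairs] n_subsets[OF finite_ground, of 2] by simp
qed

lemma all_pairs_cross:
  assumes "card eq_points = card E choose 2" "e \<in> E" "f \<in> E" "e \<noteq> f"
  shows "\<exists>t\<in>I. weight a b e t = weight a b f t"
proof -
  obtain S where S: "inj_on S eq_points" "S ` eq_points \<subseteq> {S. S \<subseteq> E \<and> card S = 2}"
    "\<forall>t\<in>eq_points. \<forall>e\<in>S t. \<forall>f\<in>S t. weight a b e t = weight a b f t"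
    using eq_points_inj_pairs by (elim exE conjE) (rule that)
  have "S ` eq_points = {S. S \<subseteq> E \<and> card S = 2}"
    using card_subset_eq[OF finite_pairs S(2)] card_image[OF S(1)] assms(1)
      n_subsets[OF finite_ground, of 2] by simp
  then have "{e, f} \<in> S ` eq_points" using assms by simp
  then obtain t where t: "t \<in> eq_points" "{e, f} = S t" by (rule imageE)
  then have "weight a b e t = weight a b f t" using S(3) by blast
  moreover have "t \<in> I" using t(1) by (simp add: eq_points_def)
  ultimately show ?thesis by blast
qed

text \<open>An equality point is neutral if one of the two elements that tie is spanned by no set of
  other elements that are at most as heavy.\<close>

definition neutral :: "real \<Rightarrow> bool" where
  "neutral \<tau> \<longleftrightarrow> (\<exists>p\<in>E. \<exists>q\<in>E. p \<noteq> q \<and> weight a b p \<tau> = weight a b q \<tau> \<and>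
     (\<forall>A\<in>\<F>. A \<subseteq> {x \<in> E - {q}. weight a b x \<tau> \<le> weight a b q \<tau>} \<longrightarrow> insert q A \<in> \<F>))"

text \<open>A minimum weight basis stays optimal on an interval that contains at most one equality point,
  a neutral one. If it ceased to be optimal at the tie of \<^term>\<open>e\<close> and \<^term>\<open>f\<close>, then both
  would lie in a fundamental circuit all of whose elements are at most as heavy as they are.\<close>

lemma min_base_steady:
  assumes J: "is_interval J" "J \<subseteq> I" "s \<in> J" "s \<notin> eq_points" "t \<in> J"
    and neut: "\<And>\<tau>. \<tau> \<in> J \<Longrightarrow> \<tau> \<in> eq_points \<Longrightarrow> \<tau> = \<tau>\<^sub>0 \<and> neutral \<tau>"
    and B: "min_base (\<lambda>e. weight a b e s) F B"
  shows "min_base (\<lambda>e. weight a b e t) F B"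
proof (rule locally_min_imp_min_base)
  show "B \<in> bases_avoiding F" using B by (simp add: min_base_def)
  then have B1: "B \<in> \<F>" "card B = matroid_rank \<F>" "B \<inter> F = {}" and BE: "B \<subseteq> E"
    using indep_subset_ground by (auto simp: bases_avoiding_def)
  have seg: "closed_segment x z \<subseteq> J" if "x \<in> J" "z \<in> J" for x z
    using closed_segment_subset[OF that] J(1) by (simp add: is_interval_convex_1)
  fix e f assume e: "e \<in> B" and f: "f \<in> E - B - F" and ef: "insert f (B - {e}) \<in> \<F>"
  show "weight a b e t \<le> weight a b f t"
  proof (rule ccontr)
    assume "\<not> weight a b e t \<le> weight a b f t"
    moreover have "weight a b e s \<le> weight a b f s"
      using min_base_exchange_le[OF B e] f ef by blast
    ultimately obtain \<tau> where "\<tau> \<in> closed_segment s t" "weight a b e \<tau> = weight a b f \<tau>"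
      using weight_crossing[of a b e s f t] by (auto simp: not_le)
    then have \<tau>: "\<tau> \<in> J" "weight a b e \<tau> = weight a b f \<tau>" using seg[OF J(3,5)] by auto
    have neq: "e \<in> E" "f \<in> E" "e \<noteq> f" using e f BE by auto
    then have "\<tau> \<in> eq_points" using \<tau> J(2) unfolding eq_points_def by blast
    note neut\<tau> = neut[OF \<tau>(1) this]
    have "\<tau> = \<tau>\<^sub>0" by (rule conjunct1[OF neut\<tau>])
    have "neutral \<tau>" by (rule conjunct2[OF neut\<tau>])
    then obtain p q where pq: "p \<in> E" "q \<in> E" "p \<noteq> q" "weight a b p \<tau> = weight a b q \<tau>"
      and free: "\<forall>A\<in>\<F>. A \<subseteq> {x \<in> E - {q}. weight a b x \<tau> \<le> weight a b q \<tau>} \<longrightarrow> insert q A \<in> \<F>"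
      unfolding neutral_def by (elim bexE conjE) (rule that)
    have "{e, f} = {p, q}"
      by (rule unique_tie[OF _ _ neq(3) pq(3) \<tau>(2) pq(4)]) (use \<tau>(1) J(2) neq pq in blast)+
    then have q: "q = e \<or> q = f" by blast
    then have wq: "weight a b q \<tau> = weight a b f \<tau>" using \<tau>(2) by blast
    let ?A = "{y \<in> B. insert f (B - {y}) \<in> \<F>}"
    have dep: "insert f ?A \<notin> \<F>"
      by (rule fundamental_circuit_dependent[OF B1(1,2)]) (use f in blast)
    \<comment> \<open>Removing either \<^term>\<open>e\<close> or \<^term>\<open>f\<close> from the circuit leaves an independent set.\<close>
    have "insert f ?A - {q} \<in> \<F>"
      using q
    proof
      assume "q = e"
      then show ?thesis using indep_subset[OF ef, of "insert f ?A - {q}"] by blast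
    next
      assume "q = f"
      then show ?thesis using indep_subset[OF B1(1), of "insert f ?A - {q}"] by blast
    qed
    moreover have "insert f ?A - {q} \<subseteq> {x \<in> E - {q}. weight a b x \<tau> \<le> weight a b q \<tau>}"
    proof
      fix x assume x: "x \<in> insert f ?A - {q}"
      have "weight a b x \<tau> \<le> weight a b f \<tau>"
      proof (rule ccontr)
        \<comment> \<open>Otherwise \<^term>\<open>x\<close> and \<^term>\<open>f\<close> would tie at a second equality point in \<^term>\<open>J\<close>.\<close>
        assume contra: "\<not> weight a b x \<tau> \<le> weight a b f \<tau>"
        then have xA: "x \<in> ?A" using x by auto
        then have "weight a b x s \<le> weight a b f s"
          using min_base_exchange_le[OF B, of x f] f by blast
        then obtain \<sigma> where \<sigma>: "\<sigma> \<in> closed_segment s \<tau>" "\<sigma> \<noteq> \<tau>"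
          "weight a b x \<sigma> = weight a b f \<sigma>"
          using weight_crossing[of a b x s f \<tau>] contra by (auto simp: not_le)
        then have "\<sigma> \<in> J" using seg[OF J(3) \<tau>(1)] by auto
        have "x \<in> E" "x \<noteq> f" using xA f BE by auto
        then have "\<sigma> \<in> eq_points" using \<sigma>(3) neq(2) J(2) \<open>\<sigma> \<in> J\<close> unfolding eq_points_def by blast
        then have "\<sigma> = \<tau>\<^sub>0" by (rule conjunct1[OF neut[OF \<open>\<sigma> \<in> J\<close>]])
        then show False using \<sigma>(2) \<open>\<tau> = \<tau>\<^sub>0\<close> by (simp only:)
      qed
      moreover have "x \<in> E - {q}" using x BE neq by blast
      ultimately show "x \<in> {x \<in> E - {q}. weight a b x \<tau> \<le> weight a b q \<tau>}"
        using wq by simp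
    qed
    ultimately have "insert q (insert f ?A - {q}) \<in> \<F>" using free by blast
    moreover have "q \<in> insert f ?A" using q e ef by blast
    ultimately show False using dep by (simp add: insert_absorb)
  qed
qed

text \<open>If all pairs of elements tie in \<^term>\<open>I\<close>, then all other elements become lighter than the
  steepest element \<^term>\<open>p\<close> in turn. When \<^term>\<open>p\<close> ties with the first element that raises the rank of the set of elements
  not heavier than \<^term>\<open>p\<close> to two, the equality point is neutral.\<close>

lemma neutral_exists:
  assumes rank: "matroid_rank \<F> \<ge> 2"
    and cross: "\<And>e f. e \<in> E \<Longrightarrow> f \<in> E \<Longrightarrow> e \<noteq> f \<Longrightarrow> \<exists>t\<in>I. weight a b e t = weight a b f t"
  shows "\<exists>\<tau>\<in>eq_points. neutral \<tau>"
proof -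
  have "matroid_rank \<F> \<in> card ` \<F>"
    unfolding matroid_rank_def using finite_family empty_indep by (intro Max_in) auto
  then obtain A where A: "A \<in> \<F>" "card A \<ge> 2" using rank by auto
  then obtain A' where "A' \<subseteq> A" "card A' = 2"
    using obtain_subset_with_card_n by metis
  then obtain x y where xy: "{x, y} \<in> \<F>" "x \<noteq> y"
    using indep_subset[OF A(1)] by (auto simp: card_2_iff)
  have xyE: "x \<in> E" "y \<in> E" using indep_subset_ground[OF xy(1)] by auto
  have "Max (b ` E) \<in> b ` E" by (rule Max_in) (use finite_ground xyE in auto)
  then obtain p where p: "p \<in> E" "b p = Max (b ` E)" by auto
  then have p_max: "b x \<le> b p" if "x \<in> E" for x
    using that finite_ground by simp
  obtain c where c: "\<And>x. x \<in> E - {p} \<Longrightarrow> c x \<in> I \<and> weight a b p (c x) = weight a b x (c x)"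
    using cross[OF p(1)] by (metis DiffE singletonI)
  have slope: "(of_rat (b x) :: real) < of_rat (b p)" if x: "x \<in> E - {p}" for x
  proof -
    have "b x \<noteq> b p"
    proof
      assume "b x = b p"
      moreover from this have "(of_rat (a x) :: real) = of_rat (a p)"
        using c[OF x] by (simp add: weight_def)
      ultimately have "weight a b x = weight a b p" by (intro ext) (simp add: weight_def)
      then show False using weights_distinct[of x p] x p by auto
    qed
    then show ?thesis using p_max[of x] x by (simp add: of_rat_less)
  qed
  have before: "c x \<le> t" if x: "x \<in> E - {p}" and t: "weight a b x t \<le> weight a b p t" for x t
  proof (rule ccontr)
    assume "\<not> c x \<le> t"
    then have "(c x - t) * (of_rat (b p) - of_rat (b x)) > (0::real)"
      using slope[OF x] by simp
    then show False using t c[OF x] by (simp add: weight_def algebra_simps)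
  qed
  have inj: "x = y" if "x \<in> E - {p}" "y \<in> E - {p}" "c x = c y" for x y
  proof -
    have "{p, x} = {p, y}"
      by (rule unique_tie[of "c x"]) (use that c[OF that(1)] c[OF that(2)] p in auto)
    then show ?thesis using that by (auto simp: doubleton_eq_iff)
  qed
  \<comment> \<open>\<^term>\<open>c x\<close> is the parameter from which on \<^term>\<open>x\<close> is at most as heavy as
    \<^term>\<open>p\<close>, so \<open>prev q\<close> consists of \<^term>\<open>p\<close> and the elements that tie with it before \<^term>\<open>q\<close> does.\<close>
  define prev where "prev q = {s \<in> E - {q}. s = p \<or> c s < c q}" for q
  define Q where "Q = {q \<in> E - {p}. \<exists>s\<in>prev q. {q, s} \<in> \<F>}"
  have pair: "\<exists>q\<in>Q. q \<in> {u, v}" if uv: "{u, v} \<in> \<F>" "u \<noteq> v" for u v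
  proof -
    have E: "u \<in> E" "v \<in> E" using indep_subset_ground[OF uv(1)] by auto
    have comm: "{v, u} \<in> \<F>" using uv(1) by (simp add: insert_commute)
    consider "u = p" | "v = p" | "u \<noteq> p" "v \<noteq> p" "c u < c v" | "u \<noteq> p" "v \<noteq> p" "c v < c u"
      using inj[of u v] E uv(2) by fastforce
    then show ?thesis
      using E uv comm unfolding Q_def prev_def by cases auto
  qed
  have "Q \<noteq> {}" "finite Q" using pair[OF xy] finite_ground by (auto simp: Q_def)
  then obtain q where q: "q \<in> Q" "\<And>q'. q' \<in> Q \<Longrightarrow> c q \<le> c q'"
    using arg_min_if_finite[of Q c] by (metis linorder_not_le)
  then obtain s where s: "s \<in> prev q" "{q, s} \<in> \<F>" and qE: "q \<in> E - {p}" by (auto simp: Q_def)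
  have "insert q A \<in> \<F>"
    if A: "A \<in> \<F>" "A \<subseteq> {x \<in> E - {q}. weight a b x (c q) \<le> weight a b q (c q)}" for A
  proof (rule ccontr)
    assume "insert q A \<notin> \<F>"
    then obtain u where u: "u \<in> A - {q, s}" "insert u ({q, s} - {q}) \<in> \<F>"
      using exchange_against_spanning[OF A(1) _ s(2)] by blast
    have "s \<noteq> q" using s by (simp add: prev_def)
    then have us: "{u, s} \<in> \<F>" "u \<noteq> s" using u by (auto simp: insert_Diff_if)
    have "u \<in> prev q"
      using before[of u "c q"] inj[of u q] u A(2) qE c[OF qE] by (force simp: prev_def)
    then obtain q' where "q' \<in> Q" "q' \<in> prev q" "q' \<noteq> p"
      using pair[OF us] s by (auto simp: Q_def)
    then show False using q(2)[of q'] by (auto simp: prev_def)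
  qed
  then have "\<forall>A\<in>\<F>. A \<subseteq> {x \<in> E - {q}. weight a b x (c q) \<le> weight a b q (c q)} \<longrightarrow> insert q A \<in> \<F>"
    by (intro ballI impI)
  moreover have pq: "q \<in> E" "p \<noteq> q" "c q \<in> I" "weight a b p (c q) = weight a b q (c q)"
    using qE c[OF qE] by blast+
  ultimately have "neutral (c q)"
    unfolding neutral_def using p(1) by (intro bexI[of _ p] bexI[of _ q] conjI)
  moreover have "c q \<in> eq_points"
    unfolding eq_points_def using p(1) pq by blast
  ultimately show ?thesis by blast
qed

text \<open>Points at which the interval is cut: all equality points, except that a neutral one is left
  out when the rank is at least two and the bound on their number is attained.\<close>

lemma essential_points:
  "\<exists>P \<tau>\<^sub>0. finite P \<and> card P \<le> card E choose 2 \<and>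
    (matroid_rank \<F> \<ge> 2 \<longrightarrow> card P + 1 \<le> card E choose 2) \<and>
    (\<forall>\<tau>\<in>eq_points - P. \<tau> = \<tau>\<^sub>0 \<and> neutral \<tau>)"
proof (cases "matroid_rank \<F> \<ge> 2 \<and> card eq_points = card E choose 2")
  case True
  then obtain \<tau>\<^sub>0 where \<tau>: "\<tau>\<^sub>0 \<in> eq_points" "neutral \<tau>\<^sub>0"
    using neutral_exists all_pairs_cross by blast
  have "card (eq_points - {\<tau>\<^sub>0}) + 1 = card eq_points"
    using card_Suc_Diff1[OF eq_points_card(1) \<tau>(1)] by simp
  then show ?thesis
    using eq_points_card \<tau> by (intro exI[of _ "eq_points - {\<tau>\<^sub>0}"] exI[of _ \<tau>\<^sub>0]) auto
next
  case False
  then show ?thesis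
    using eq_points_card by (intro exI[of _ eq_points]) auto
qed

section \<open>The interdiction value\<close>

lemma bases_avoiding_nonempty:
  assumes F: "F \<subseteq> E" "card F \<le> l"
  shows "bases_avoiding F \<noteq> {}"
proof -
  have fin: "finite F" using F finite_ground finite_subset by blast
  have "l - card F \<le> card (E - F)"
    using card_Diff_subset[OF fin F(1)] l_le_card by simp
  then obtain T where T: "T \<subseteq> E - F" "card T = l - card F" "finite T"
    using obtain_subset_with_card_n by metis
  then have "card (F \<union> T) = l" using card_Un_disjoint[OF fin T(3)] F by auto
  then have "bases_avoiding (F \<union> T) \<noteq> {}" using rank_deletion[of "F \<union> T"] F T by blast
  then show ?thesis by (auto simp: bases_avoiding_def)
qed

lemma is_basis_interdict_iff:
  assumes "bases_avoiding F \<noteq> {}"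
  shows "is_basis (interdict \<F> F) B \<longleftrightarrow> B \<in> bases_avoiding F"
proof
  assume B: "is_basis (interdict \<F> F) B"
  then have B1: "B \<in> \<F>" "B \<inter> F = {}" by (auto simp: is_basis_def interdict_def)
  obtain B0 where B0: "B0 \<in> \<F>" "card B0 = matroid_rank \<F>" "B0 \<inter> F = {}"
    using assms by (auto simp: bases_avoiding_def)
  have "\<not> card B < card B0"
  proof
    assume "card B < card B0"
    then obtain e where e: "e \<in> B0 - B" "insert e B \<in> \<F>"
      using augmentation[OF B1(1) B0(1)] by blast
    then have "insert e B \<in> interdict \<F> F" using B1 B0 by (auto simp: interdict_def)
    then have "insert e B = B" using B by (auto simp: is_basis_def)
    then show False using e by blast
  qed
  then show "B \<in> bases_avoiding F"
    using card_le_rank[OF B1(1)] B0(2) B1 by (simp add: bases_avoiding_def)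
next
  assume B: "B \<in> bases_avoiding F"
  have "A = B" if "A \<in> \<F>" "B \<subseteq> A" for A
    using card_seteq[OF finite_indep[OF that(1)] that(2)] card_le_rank[OF that(1)] B
    by (simp add: bases_avoiding_def)
  then show "is_basis (interdict \<F> F) B"
    using B by (auto simp: is_basis_def interdict_def bases_avoiding_def)
qed

lemma interdicted_value_eq:
  assumes r: "linear_order_on E r" and B: "min_base (\<lambda>e. weight a b e t) F B"
  shows "interdicted_value r a b \<F> F t = (\<Sum>e\<in>B. weight a b e t)"
proof -
  have ne: "bases_avoiding F \<noteq> {}" using B by (auto simp: min_base_def)
  have "is_min_basis a b (interdict \<F> F) t (opt_basis r a b (interdict \<F> F) t)"
    using theI'[OF opt_basis_unique[OF matroid_axioms r, of a b F t]]
    unfolding opt_basis_def by blast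
  then have "min_base (\<lambda>e. weight a b e t) F (opt_basis r a b (interdict \<F> F) t)"
    by (simp add: is_min_basis_def is_basis_interdict_iff[OF ne] min_base_def set_weight_def)
  then show ?thesis
    using B by (auto simp: interdicted_value_def set_weight_def min_base_def intro: antisym)
qed

text \<open>The case that \<^term>\<open>J\<close> contains at most the neutral point is separate, because there an
  optimal basis need not be unique at any point of \<^term>\<open>J\<close>.\<close>

lemma changepoints_on_piece:
  assumes r: "linear_order_on E r"
    and J: "is_interval J" "J \<subseteq> I"
    and neut: "\<And>\<tau>. \<tau> \<in> J \<Longrightarrow> \<tau> \<in> eq_points \<Longrightarrow> \<tau> = \<tau>\<^sub>0 \<and> neutral \<tau>"
    and k: "matroid_rank \<F> > 0"
  defines "y \<equiv> opt_interdiction_value r a b E \<F> l"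
  shows "finite (changepoints J y) \<and>
    card (changepoints J y) + 1 \<le> (matroid_rank \<F> + l - 1) choose l"
proof (cases "J \<subseteq> {\<tau>\<^sub>0}")
  case True
  have "at t within J = bot" if "t \<in> J" for t
  proof -
    have "J - {t} = {}" using that True by blast
    then show ?thesis by (simp only: at_within_eq_bot_iff closure_empty) simp
  qed
  then have "changepoints J y = {}" by (auto simp: changepoints_def)
  then show ?thesis using k by (simp add: Suc_le_eq)
next
  case False
  then obtain s where s: "s \<in> J" "s \<notin> eq_points" using neut by blast
  define \<beta> where "\<beta> F = (SOME B. min_base (\<lambda>e. weight a b e s) F B)" for F
  have \<beta>: "min_base (\<lambda>e. weight a b e t) F (\<beta> F)" if "F \<subseteq> E" "card F \<le> l" "t \<in> J" for F t
  proof -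
    have B: "min_base (\<lambda>e. weight a b e s) F (\<beta> F)"
      unfolding \<beta>_def using min_base_exists[OF bases_avoiding_nonempty[OF that(1,2)]] by (rule someI_ex)
    show ?thesis by (rule min_base_steady[OF J s that(3) _ B]) (rule neut)
  qed
  have inj: "inj_on (\<lambda>e. weight a b e s) E"
    using s J(2) by (auto simp: inj_on_def eq_points_def)
  define v where "v t F = (\<Sum>e\<in>\<beta> F. weight a b e t)" for t F
  have "\<exists>C. finite C \<and> C \<noteq> {} \<and> card C \<le> (matroid_rank \<F> + l - 1) choose l \<and>
    (\<forall>F'\<in>C. F' \<subseteq> E \<and> card F' = l) \<and>
    (\<forall>F. F \<subseteq> E \<and> card F = l \<longrightarrow> (\<exists>F'\<in>C. \<forall>t\<in>J. v t F \<le> v t F'))"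
    unfolding v_def
    by (rule candidates[where w = "\<lambda>t e. weight a b e t" and s = s]) (use \<beta> s inj k in auto)
  then obtain C where C: "finite C" "C \<noteq> {}" "card C \<le> (matroid_rank \<F> + l - 1) choose l"
    "\<forall>F'\<in>C. F' \<subseteq> E \<and> card F' = l"
    and dom: "\<forall>F. F \<subseteq> E \<and> card F = l \<longrightarrow> (\<exists>F'\<in>C. \<forall>t\<in>J. v t F \<le> v t F')"
    by (elim exE conjE) (rule that)
  define \<FF> where "\<FF> = {F. F \<subseteq> E \<and> card F = l}"
  have fin: "finite \<FF>" unfolding \<FF>_def
    by (rule finite_subset[of _ "Pow E"]) (use finite_ground in auto)
  have sub: "C \<subseteq> \<FF>" using C(4) by (auto simp: \<FF>_def)
  have "y t = Max ((\<lambda>F. (\<Sum>e\<in>\<beta> F. of_rat (a e)) + (\<Sum>e\<in>\<beta> F. of_rat (b e)) * t) ` C)"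
    if t: "t \<in> J" for t
  proof -
    have val: "interdicted_value r a b \<F> F t = v t F" if "F \<in> \<FF>" for F
      unfolding v_def by (rule interdicted_value_eq[OF r \<beta>]) (use that t in \<open>auto simp: \<FF>_def\<close>)
    have "y t = Max ((\<lambda>F. interdicted_value r a b \<F> F t) ` \<FF>)"
      unfolding y_def opt_interdiction_value_def \<FF>_def by (simp add: setcompr_eq_image)
    also have "(\<lambda>F. interdicted_value r a b \<F> F t) ` \<FF> = v t ` \<FF>"
      by (rule image_cong[OF refl val])
    also have "Max (v t ` \<FF>) = Max (v t ` C)"
    proof (rule antisym)
      show "Max (v t ` C) \<le> Max (v t ` \<FF>)"
        using sub fin C by (intro Max_mono) auto
      have "v t F \<le> Max (v t ` C)" if F: "F \<in> \<FF>" for F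
      proof -
        obtain F' where "F' \<in> C" "v t F \<le> v t F'" using dom F t by (auto simp: \<FF>_def)
        then show ?thesis using C(1) by (meson Max_ge finite_imageI imageI order_trans)
      qed
      then show "Max (v t ` \<FF>) \<le> Max (v t ` C)"
        using fin sub C(2) by (subst Max_le_iff) auto
    qed
    also have "v t ` C = (\<lambda>F. (\<Sum>e\<in>\<beta> F. of_rat (a e)) + (\<Sum>e\<in>\<beta> F. of_rat (b e)) * t) ` C"
      by (simp add: v_def weight_def sum.distrib sum_distrib_left mult.commute[of _ t])
    finally show ?thesis .
  qed
  then have "finite (changepoints J y) \<and> card (changepoints J y) + 1 \<le> card C"
    by (rule changepoints_Max_affine[OF C(1,2)])
  then show ?thesis using C(3) by linarith
qed

lemma changepoints_bound:
  assumes r: "linear_order_on E r" and k: "matroid_rank \<F> > 0"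
  defines "y \<equiv> opt_interdiction_value r a b E \<F> l"
  shows "finite (changepoints I y) \<and>
    card (changepoints I y) \<le> (card E choose 2) * ((matroid_rank \<F> + l - 1) choose l)"
proof -
  obtain P \<tau>\<^sub>0 where P: "finite P" "card P \<le> card E choose 2"
    "matroid_rank \<F> \<ge> 2 \<longrightarrow> card P + 1 \<le> card E choose 2"
    and neut: "\<forall>\<tau>\<in>eq_points - P. \<tau> = \<tau>\<^sub>0 \<and> neutral \<tau>"
    using essential_points by (elim exE conjE) (rule that)
  define T where "T = (matroid_rank \<F> + l - 1) choose l"
  have T: "T > 0" using k by (simp add: T_def)
  have piece: "finite (changepoints J y) \<and> card (changepoints J y) \<le> T - 1"
    if "J \<subseteq> I" "is_interval J" "J \<inter> P = {}" for J
  proof -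
    have "finite (changepoints J y) \<and> card (changepoints J y) + 1 \<le> T"
      unfolding y_def T_def
      by (rule changepoints_on_piece[OF r that(2,1) _ k, of \<tau>\<^sub>0]) (use neut that(3) in blast)
    then show ?thesis by auto
  qed
  have "finite (changepoints I y) \<and> card (changepoints I y) \<le> card P + (card P + 1) * (T - 1)"
    by (rule changepoints_split[OF interval P(1)]) (rule piece)
  then have fin: "finite (changepoints I y)"
    and card: "card (changepoints I y) \<le> card P + (card P + 1) * (T - 1)"
    by blast+
  note card
  also have "card P + (card P + 1) * (T - 1) \<le> (card E choose 2) * T"
  proof (cases "matroid_rank \<F> \<ge> 2")
    case True
    have "card P + (card P + 1) * (T - 1) \<le> (card P + 1) * T"
      using T by (cases T) auto
    also have "\<dots> \<le> (card E choose 2) * T" using P(3)[rule_format, OF True] by (rule mult_le_mono1)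
    finally show ?thesis .
  next
    case False
    then have "matroid_rank \<F> = 1" using k by simp
    then have "T = 1" by (simp add: T_def)
    then show ?thesis using P(2) by simp
  qed
  finally show ?thesis using fin by (simp add: T_def)
qed

end

lemma binomial_le_times_binomial:
  assumes "k > 0" "l > 0"
  shows "(k + l - 1) choose l \<le> ((k + l - 2) choose (l - 1)) * (k::nat)"
proof -
  obtain k' l' where kl: "k = Suc k'" "l = Suc l'" using assms by (metis gr0_implies_Suc)
  have "(Suc (k' + l') choose Suc l') * Suc l' = Suc (k' + l') * ((k' + l') choose l')"
    using Suc_times_binomial_eq by simp
  also have "\<dots> \<le> (Suc k' * Suc l') * ((k' + l') choose l')"
    by (rule mult_le_mono1) simp
  finally have "(Suc (k' + l') choose Suc l') * Suc l' \<le> (((k' + l') choose l') * Suc k') * Suc l'"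
    by (simp only: mult_ac)
  then have "Suc (k' + l') choose Suc l' \<le> ((k' + l') choose l') * Suc k'"
    by (subst (asm) mult_le_cancel2) simp
  then show ?thesis using kl by (simp del: binomial_Suc_Suc)
qed

lemma bound_in_bigo:
  "(\<lambda>(m, k). real ((m choose 2) * ((k + l - 2) choose (l - 1)) * k))
     \<in> O[top](\<lambda>(m, k). real (m\<^sup>2 * (k + l) ^ (l - 1) * k))"
proof -
  have le: "n choose j \<le> n ^ j" for n j :: nat
    by (cases "j \<le> n") (auto intro: binomial_le_pow simp: binomial_eq_0)
  have "(m choose 2) * ((k + l - 2) choose (l - 1)) * k \<le> m\<^sup>2 * (k + l) ^ (l - 1) * k" for m k
  proof (intro mult_le_mono le order_refl)
    have "(k + l - 2) choose (l - 1) \<le> (k + l - 2) ^ (l - 1)" by (rule le)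
    also have "\<dots> \<le> (k + l) ^ (l - 1)" by (rule power_mono) auto
    finally show "(k + l - 2) choose (l - 1) \<le> (k + l) ^ (l - 1)" .
  qed
  then show ?thesis
    by (intro bigoI[of _ 1] always_eventually) (auto simp del: of_nat_mult of_nat_power of_nat_add)
qed

theorem corollary3p11:
  fixes E :: "'a set" and \<F> :: "'a set set" and a b :: "'a \<Rightarrow> rat"
    and I :: "real set" and r :: "'a rel" and k l m :: nat
  assumes "matroid E \<F>"
    and "m = card E"
    and "k = matroid_rank \<F>"
    and "is_interval I"
    and "l > 0"
    and "linear_order_on E r"
    and "\<And>F. F \<subseteq> E \<Longrightarrow> card F = l \<Longrightarrow> \<exists>B. is_basis (interdict \<F> F) B \<and> card B = k"
    and "\<And>t e f g h. t \<in> I \<Longrightarrow> {e, f, g, h} \<subseteq> E \<Longrightarrow> e \<noteq> f \<Longrightarrow> g \<noteq> h \<Longrightarrow>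
           weight a b e t = weight a b f t \<Longrightarrow> weight a b g t = weight a b h t \<Longrightarrow>
           {e, f} = {g, h}"
    and "\<And>e f. e \<in> E \<Longrightarrow> f \<in> E \<Longrightarrow> e \<noteq> f \<Longrightarrow> weight a b e \<noteq> weight a b f"
  shows "finite (changepoints I (opt_interdiction_value r a b E \<F> l)) \<and>
         card (changepoints I (opt_interdiction_value r a b E \<F> l))
           \<le> (m choose 2) * ((k + l - 2) choose (l - 1)) * k \<and>
         (\<lambda>(m, k). real ((m choose 2) * ((k + l - 2) choose (l - 1)) * k))
           \<in> O[top](\<lambda>(m, k). real (m\<^sup>2 * (k + l) ^ (l - 1) * k))"
proof (intro conjI)
  let ?y = "opt_interdiction_value r a b E \<F> l"
  interpret M: matroid E \<F> by fact
  have "finite (changepoints I ?y) \<and>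
    card (changepoints I ?y) \<le> (m choose 2) * ((k + l - 2) choose (l - 1)) * k"
  proof (cases "l \<le> card E \<and> k > 0")
    case True
    have ne: "M.bases_avoiding F \<noteq> {}" if F: "F \<subseteq> E" "card F = l" for F
    proof -
      obtain B where "is_basis (interdict \<F> F) B" "card B = k" using assms(7)[OF F] by blast
      then have "B \<in> M.bases_avoiding F"
        using assms(3) by (auto simp: M.bases_avoiding_def is_basis_def interdict_def)
      then show ?thesis by blast
    qed
    interpret parametric_interdiction E \<F> a b I l
    proof
      show "is_interval I" by fact
      show "l \<le> card E" using True by blast
      show "M.bases_avoiding F \<noteq> {}" if "F \<subseteq> E" "card F = l" for F
        using that by (rule ne)
      show "{e, f} = {g, h}" if "t \<in> I" "{e, f, g, h} \<subseteq> E" "e \<noteq> f" "g \<noteq> h"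
        "weight a b e t = weight a b f t" "weight a b g t = weight a b h t" for t e f g h
        using that by (rule assms(8))
      show "weight a b e \<noteq> weight a b f" if "e \<in> E" "f \<in> E" "e \<noteq> f" for e f
        using that by (rule assms(9))
    qed
    have "finite (changepoints I ?y) \<and>
      card (changepoints I ?y) \<le> (m choose 2) * ((k + l - 1) choose l)"
      using changepoints_bound[OF assms(6)] True assms(2,3) by simp
    moreover have "(m choose 2) * ((k + l - 1) choose l)
        \<le> (m choose 2) * (((k + l - 2) choose (l - 1)) * k)"
      by (rule mult_le_mono2, rule binomial_le_times_binomial) (use True assms(5) in auto)
    ultimately show ?thesis unfolding mult.assoc by (blast intro: order_trans)
  next
    case False
    \<comment> \<open>For \<^term>\<open>k = 0\<close> the value is zero. For \<^term>\<open>l > card E\<close> there is no set to interdict, and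
      the value is the unspecified but constant maximum of the empty set.\<close>
    have "\<exists>c. ?y = (\<lambda>_. c)"
    proof (cases "l \<le> card E")
      case True
      then have k: "k = 0" using False by simp
      have empty: "B = {}" if "is_basis (interdict \<F> F) B" for F B
        using that M.card_le_rank[of B] M.finite_indep[of B] k assms(3)
        by (auto simp: is_basis_def interdict_def)
      have "interdicted_value r a b \<F> F t = 0" for F t
      proof -
        have "is_min_basis a b (interdict \<F> F) t (opt_basis r a b (interdict \<F> F) t)"
          using theI'[OF opt_basis_unique[OF assms(1,6), of a b F t]]
          unfolding opt_basis_def by blast
        then have "opt_basis r a b (interdict \<F> F) t = {}"
          using empty by (auto simp: is_min_basis_def)
        then show ?thesis by (simp add: interdicted_value_def set_weight_def)
      qed
      then show ?thesis unfolding opt_interdiction_value_def by auto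
    next
      case False
      then have "\<not> (F \<subseteq> E \<and> card F = l)" for F
        using card_mono[OF M.finite_ground, of F] by auto
      then have "?y = (\<lambda>_. Max {})"
        unfolding opt_interdiction_value_def by (simp only: simp_thms Collect_empty_eq empty_def)
      then show ?thesis by blast
    qed
    then show ?thesis using changepoints_const by (metis card.empty finite.emptyI zero_le)
  qed
  then show "finite (changepoints I ?y)"
    "card (changepoints I ?y) \<le> (m choose 2) * ((k + l - 2) choose (l - 1)) * k"
    by auto
qed (rule bound_in_bigo)

end
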